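(* Let $\mathcal{H}$ be a Hilbert space and let $\mathcal{L}:\mathcal{D}(\mathcal{L})\subset\mathcal{H}\to\mathcal{H}$ be a densely defined linear operator such that: (1) $\mathcal{L}=\mathcal{L}^*$; (2) there is $\gamma>0$ with $\langle\phi,\mathcal{L}\phi\rangle\le-\gamma\|\phi\|^2$ for all $\phi\in\mathcal{D}(\mathcal{L})$; (3) $\mathcal{H}$ has a complete orthonormal system $\{\phi_k\}_{k=1}^\infty$ of eigenfunctions of $\mathcal{L}$, $\mathcal{L}\phi_k=\lambda_k\phi_k$, with real eigenvalues $\lambda_k<0$; (4) $\mathcal{L}$ generates a strongly continuous semigroup $\{e^{\mathcal{L}t}\}_{t\ge0}$ on $\mathcal{H}$ with $\|e^{\mathcal{L}t}\|\le e^{-\gamma t}$ for all $t\ge0$, with $\gamma$ as in (2). Let $Q:\mathcal{H}\to\mathcal{H}$ be a bounded positive self-adjoint operator, and let $P:\mathcal{H}\to\mathcal{H}$ be the energy covariance operator, defined by $$\langle\phi,P\psi\rangle=\int_0^\infty\langle\phi,e^{\mathcal{L}t}Qe^{\mathcal{L}t}\psi\rangle\,\mathrm{d}t\qquad\text{for all }\phi,\psi\in\mathcal{H}.$$ Then: (i) $\langle\phi,P\phi\rangle\ge0$ for all $\phi\in\mathcal{H}$; (ii) $P^*=P$; (iii) $\mathcal{L}P+P\mathcal{L}=-Q$ on $\mathcal{D}(\mathcal{L})$; (iv) the integral defining $\langle\phi,P\psi\rangle$ converges absolutely for all $\phi,\psi\in\mathcal{H}$.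
   Context: $\langle\cdot,\cdot\rangle$ is the inner product of $\mathcal{H}$ (linear in the second argument), $\|\cdot\|$ the induced norm on vectors and the operator norm on bounded operators. "Positive" means $\langle\phi,Q\phi\rangle\ge0$ for all $\phi\in\mathcal{H}$. The identity $\mathcal{L}P+P\mathcal{L}=-Q$ on $\mathcal{D}(\mathcal{L})$ means that for every $\psi\in\mathcal{D}(\mathcal{L})$ one has $P\psi\in\mathcal{D}(\mathcal{L})$ and $\mathcal{L}P\psi+P\mathcal{L}\psi=-Q\psi$. (In the paper $Q$ is the covariance operator of a white-in-time noise forcing the equation $\mathrm{d}u/\mathrm{d}t=\mathcal{L}u+\xi(t)$; only the listed properties of $Q$ enter the statement.) *)

theory Defs
  imports "HOL-Analysis.Analysis" "HOL-Library.Complex_Order"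
begin

text \<open>
  Complex inner product spaces, linear in the second argument. The class extends
  \<^class>\<open>real_inner\<close> by way of the underlying real inner product, the real part of
  the complex one. Positive definiteness of \<open>cinner\<close> and the fact that the norm is the one
  induced by \<open>cinner\<close> are thereby inherited from \<^class>\<open>real_inner\<close>.
\<close>

class complex_inner = real_inner +
  fixes scaleC :: "complex \<Rightarrow> 'a \<Rightarrow> 'a" (infixr "*\<^sub>C" 75)
    and cinner :: "'a \<Rightarrow> 'a \<Rightarrow> complex"
  assumes scaleC_add_right: "a *\<^sub>C (x + y) = a *\<^sub>C x + a *\<^sub>C y"
    and scaleC_add_left: "(a + b) *\<^sub>C x = a *\<^sub>C x + b *\<^sub>C x"
    and scaleC_scaleC: "a *\<^sub>C b *\<^sub>C x = (a * b) *\<^sub>C x"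
    and scaleC_of_real: "complex_of_real r *\<^sub>C x = r *\<^sub>R x"
    and cinner_commute: "cinner x y = cnj (cinner y x)"
    and cinner_add_right: "cinner x (y + z) = cinner x y + cinner x z"
    and cinner_scaleC_right: "cinner x (a *\<^sub>C y) = a * cinner x y"
    and inner_eq_Re_cinner: "inner x y = Re (cinner x y)"

class chilbert_space = complex_inner + complete_space

text \<open>
  A possibly unbounded operator is given by its domain \<open>D\<close> and a total function \<open>L\<close>
  whose values outside \<open>D\<close> are irrelevant. Everywhere defined operators have domain \<open>UNIV\<close>.
\<close>

definition csubspace :: "'a::complex_inner set \<Rightarrow> bool" where
  "csubspace D \<longleftrightarrow> 0 \<in> D \<and> (\<forall>x\<in>D. \<forall>y\<in>D. x + y \<in> D) \<and> (\<forall>a. \<forall>x\<in>D. a *\<^sub>C x \<in> D)"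

definition linear_operator :: "'a::complex_inner set \<Rightarrow> ('a \<Rightarrow> 'a) \<Rightarrow> bool" where
  "linear_operator D L \<longleftrightarrow> csubspace D \<and>
     (\<forall>x\<in>D. \<forall>y\<in>D. L (x + y) = L x + L y) \<and> (\<forall>a. \<forall>x\<in>D. L (a *\<^sub>C x) = a *\<^sub>C L x)"

definition densely_defined :: "'a::complex_inner set \<Rightarrow> bool" where
  "densely_defined D \<longleftrightarrow> closure D = UNIV"

definition bounded_operator :: "('a::complex_inner \<Rightarrow> 'a) \<Rightarrow> bool" where
  "bounded_operator A \<longleftrightarrow> linear_operator UNIV A \<and> bounded_linear A"

definition adjoint_domain :: "'a::complex_inner set \<Rightarrow> ('a \<Rightarrow> 'a) \<Rightarrow> 'a set" where
  "adjoint_domain D L = {\<phi>. \<exists>\<eta>. \<forall>\<psi>\<in>D. cinner \<phi> (L \<psi>) = cinner \<eta> \<psi>}"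

text \<open>The vector \<open>\<eta>\<close> below is unique when \<open>D\<close> is dense.\<close>

definition hilbert_adjoint :: "'a::complex_inner set \<Rightarrow> ('a \<Rightarrow> 'a) \<Rightarrow> 'a \<Rightarrow> 'a" where
  "hilbert_adjoint D L \<phi> = (THE \<eta>. \<forall>\<psi>\<in>D. cinner \<phi> (L \<psi>) = cinner \<eta> \<psi>)"

definition self_adjoint :: "'a::complex_inner set \<Rightarrow> ('a \<Rightarrow> 'a) \<Rightarrow> bool" where
  "self_adjoint D L \<longleftrightarrow> adjoint_domain D L = D \<and> (\<forall>\<phi>\<in>D. hilbert_adjoint D L \<phi> = L \<phi>)"

text \<open>
  Here and below, \<open>\<le>\<close> on complex numbers is that of \<^theory>\<open>HOL-Library.Complex_Order\<close>:
  real parts are compared and imaginary parts agree.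
\<close>

definition positive_operator :: "('a::complex_inner \<Rightarrow> 'a) \<Rightarrow> bool" where
  "positive_operator A \<longleftrightarrow> (\<forall>\<phi>. 0 \<le> cinner \<phi> (A \<phi>))"

definition complete_orthonormal_system :: "(nat \<Rightarrow> 'a::complex_inner) \<Rightarrow> bool" where
  "complete_orthonormal_system e \<longleftrightarrow>
     (\<forall>j k. cinner (e j) (e k) = (if j = k then 1 else 0)) \<and>
     (\<forall>x. (\<forall>k. cinner (e k) x = 0) \<longrightarrow> x = 0)"

text \<open>Semigroups are functions on \<^typ>\<open>real\<close>; their values at negative times are irrelevant.\<close>

definition strongly_continuous_semigroup :: "(real \<Rightarrow> 'a::complex_inner \<Rightarrow> 'a) \<Rightarrow> bool" where
  "strongly_continuous_semigroup S \<longleftrightarrow>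
     (\<forall>t\<ge>0. bounded_operator (S t)) \<and>
     (\<forall>x. S 0 x = x) \<and>
     (\<forall>s\<ge>0. \<forall>t\<ge>0. \<forall>x. S (s + t) x = S s (S t x)) \<and>
     (\<forall>x. ((\<lambda>t. S t x) \<longlongrightarrow> x) (at_right 0))"

definition generates ::
    "'a::complex_inner set \<Rightarrow> ('a \<Rightarrow> 'a) \<Rightarrow> (real \<Rightarrow> 'a \<Rightarrow> 'a) \<Rightarrow> bool" where
  "generates D L S \<longleftrightarrow>
     D = {x. \<exists>y. ((\<lambda>t. (S t x - x) /\<^sub>R t) \<longlongrightarrow> y) (at_right 0)} \<and>
     (\<forall>x\<in>D. ((\<lambda>t. (S t x - x) /\<^sub>R t) \<longlongrightarrow> L x) (at_right 0))"

definition energy_covariance ::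
    "(real \<Rightarrow> 'a::complex_inner \<Rightarrow> 'a) \<Rightarrow> ('a \<Rightarrow> 'a) \<Rightarrow> 'a \<Rightarrow> 'a" where
  "energy_covariance S Q \<psi> =
     (THE \<eta>. \<forall>\<phi>. cinner \<phi> \<eta> = (LINT t:{0..}|lborel. cinner \<phi> (S t (Q (S t \<psi>)))))"

end

theory Submission
  imports Defs "HOL-Real_Asymp.Real_Asymp"
begin

text \<open>
  The vector \<open>P \<psi>\<close> is the integral over \<open>t \<ge> 0\<close> of the vectors \<open>S t (Q (S t \<psi>))\<close>. These
  depend continuously on \<open>t\<close> and decay like \<open>exp (- 2 * \<gamma> * t)\<close>, so that the integrals over
  \<open>{0..T}\<close> converge in norm by completeness, and all the weak integrals
  converge absolutely. The limit represents the weak integrals, hence \<open>P\<close> is well defined, and it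
  is bounded (\<open>energy_covariance_represents\<close>).

  Symmetry and positivity of \<open>P\<close> come from those of the integrand, once each \<open>S t\<close> is
  known to be symmetric. This follows from the symmetry of the generator
  (\<open>semigroup_symmetric\<close>): for \<open>x\<close> and \<open>y\<close> in the domain the derivative of
  \<open>cinner (S (t - s) x) (S s y)\<close> in \<open>s\<close> vanishes, and the domain is dense.

  For the Lyapunov equation, the semigroup law and a shift of the time variable give
  \<open>S h (P (S h \<psi>)) = P \<psi> - (\<integral>t=0..h. S t (Q (S t \<psi>)))\<close>, and therefore
  \<open>(S h (P \<psi>) - P \<psi>) / h = - S h (P ((S h \<psi> - \<psi>) / h)) - (\<integral>t=0..h. S t (Q (S t \<psi>))) / h\<close>.
  For \<open>\<psi>\<close> in the domain the right-hand side tends to \<open>- P (L \<psi>) - Q \<psi>\<close> as \<open>h\<close> decreases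
  to \<open>0\<close>. By the definition of the generator this says both that \<open>P \<psi>\<close> is in the domain and that
  \<open>L (P \<psi>) = - P (L \<psi>) - Q \<psi>\<close> (\<open>lyapunov_equation\<close>).
\<close>

section \<open>The complex inner product\<close>

lemma norm_scaleC: "norm (a *\<^sub>C x) = cmod a * norm (x::'a::complex_inner)"
proof -
  have "cinner (a *\<^sub>C x) (a *\<^sub>C x) = a * cnj (a * cinner x x)"
    by (metis cinner_commute cinner_scaleC_right)
  also have "\<dots> = complex_of_real ((cmod a)\<^sup>2) * cinner x x"
    using cinner_commute[of x x] by (simp add: complex_norm_square[symmetric] ac_simps)
  finally have "inner (a *\<^sub>C x) (a *\<^sub>C x) = (cmod a)\<^sup>2 * inner x x"
    by (simp add: inner_eq_Re_cinner)
  then have "(norm (a *\<^sub>C x))\<^sup>2 = (cmod a * norm x)\<^sup>2"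
    by (simp add: power2_norm_eq_inner power_mult_distrib)
  then show ?thesis by (simp add: power2_eq_iff_nonneg)
qed

text \<open>
  Rotating \<open>y\<close> by a unit scalar makes \<open>cinner x y\<close> real and nonnegative, and then
  the real inequality applies.
\<close>

lemma cinner_Cauchy_Schwarz:
  "cmod (cinner x y) \<le> norm x * norm (y::'a::complex_inner)"
proof (cases "cinner x y = 0")
  case False
  define u where "u = cnj (cinner x y) / complex_of_real (cmod (cinner x y))"
  have "cmod u = 1" using False by (simp add: u_def norm_divide)
  have "cinner x y * cnj (cinner x y) = complex_of_real (cmod (cinner x y)) * complex_of_real (cmod (cinner x y))"
    by (simp add: complex_norm_square[symmetric] power2_eq_square)
  then have "cinner x (u *\<^sub>C y) = complex_of_real (cmod (cinner x y))"
    using False by (simp add: cinner_scaleC_right u_def field_simps)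
  then have "cmod (cinner x y) = inner x (u *\<^sub>C y)"
    by (simp add: inner_eq_Re_cinner)
  also have "\<dots> \<le> norm x * norm (u *\<^sub>C y)" by (rule norm_cauchy_schwarz)
  finally show ?thesis using \<open>cmod u = 1\<close> by (simp add: norm_scaleC)
qed simp

lemma bounded_bilinear_cinner:
  "bounded_bilinear (cinner :: 'a::complex_inner \<Rightarrow> 'a \<Rightarrow> complex)"
proof
  fix x y z :: 'a and r :: real
  show add: "cinner (x + y) z = cinner x z + cinner y z" for x y
    by (metis cinner_add_right cinner_commute complex_cnj_add)
  show "cinner x (y + z) = cinner x y + cinner x z" by (rule cinner_add_right)
  have scale: "cinner x (r *\<^sub>R y) = r *\<^sub>R cinner x y" for x y
    by (metis cinner_scaleC_right scaleC_of_real scaleR_conv_of_real)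
  show "cinner x (r *\<^sub>R y) = r *\<^sub>R cinner x y" by (rule scale)
  show "cinner (r *\<^sub>R x) y = r *\<^sub>R cinner x y"
    using cinner_commute[of "r *\<^sub>R x" y] cinner_commute[of x y]
    by (simp only: scale complex_cnj_scaleR)
  show "\<exists>K. \<forall>x y::'a. cmod (cinner x y) \<le> norm x * norm y * K"
    using cinner_Cauchy_Schwarz by (intro exI[of _ 1]) auto
qed

interpretation cinner: bounded_bilinear "cinner :: 'a::complex_inner \<Rightarrow> 'a \<Rightarrow> complex"
  by (rule bounded_bilinear_cinner)

lemma cinner_eqI:
  assumes "\<And>y. cinner y u = cinner y (v::'a::complex_inner)"
  shows "u = v"
proof -
  have "cinner (u - v) (u - v) = 0" using assms by (simp add: cinner.diff_right)
  then have "inner (u - v) (u - v) = 0" by (simp add: inner_eq_Re_cinner)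
  then show ?thesis by simp
qed

text \<open>Testing against a dense set suffices, since \<open>cinner\<close> is continuous.\<close>

lemma cinner_dense_eqI:
  assumes "closure D = UNIV" and "\<And>y. y \<in> D \<Longrightarrow> cinner u y = cinner (v::'a::complex_inner) y"
  shows "u = v"
proof (rule cinner_eqI)
  fix y
  have "cinner u y = cinner v y"
  proof (rule continuous_constant_on_closure[where S = D and f = "\<lambda>y. cinner u y - cinner v y" and a = 0, simplified])
    show "continuous_on (closure D) (\<lambda>y. cinner u y - cinner v y)"
      by (intro continuous_intros cinner.continuous_on)
    show "cinner u y = cinner v y" if "y \<in> D" for y using assms(2) that by simp
    show "y \<in> closure D" using assms(1) by simp
  qed
  then show "cinner y u = cinner y v" by (metis cinner_commute)
qed

lemma self_adjoint_symmetric: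
  assumes "self_adjoint D L" and "closure D = UNIV" and "x \<in> D" and "y \<in> D"
  shows "cinner x (L y) = cinner (L x) (y::'a::complex_inner)"
proof -
  have "x \<in> adjoint_domain D L" using assms by (simp add: self_adjoint_def)
  then obtain u where u: "\<And>z. z \<in> D \<Longrightarrow> cinner x (L z) = cinner u z"
    unfolding adjoint_domain_def by auto
  have "hilbert_adjoint D L x = u"
    unfolding hilbert_adjoint_def
  proof (rule the_equality)
    show "v = u" if "\<forall>z\<in>D. cinner x (L z) = cinner v z" for v
      using that u by (intro cinner_dense_eqI[OF assms(2)]) simp
  qed (use u in blast)
  moreover have "hilbert_adjoint D L x = L x" using assms by (simp add: self_adjoint_def)
  ultimately show ?thesis using u assms(4) by simp
qed

lemma symmetric_imp_self_adjoint:
  assumes "\<And>x y. cinner x (A y) = cinner (A x) (y::'a::complex_inner)"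
  shows "self_adjoint UNIV A"
  unfolding self_adjoint_def
proof (intro conjI ballI)
  show "adjoint_domain UNIV A = UNIV" using assms by (auto simp: adjoint_domain_def)
  show "hilbert_adjoint UNIV A x = A x" for x
    unfolding hilbert_adjoint_def
  proof (rule the_equality)
    show "v = A x" if "\<forall>z\<in>UNIV. cinner x (A z) = cinner v z" for v
      using that assms by (intro cinner_dense_eqI[where D = UNIV]) simp_all
  qed (use assms in blast)
qed

section \<open>Vector integrals of exponentially decaying functions\<close>

text \<open>
  Complex Hilbert spaces are Banach spaces, so that the gauge integral of continuous functions
  over compact intervals is available in them.
\<close>

instance chilbert_space \<subseteq> banach ..

text \<open>
  A Cauchy argument: the integral over \<open>{T..T'}\<close> is bounded by a tail of the integral of
  the exponential. The limit is taken over the integers first and then over all real \<open>T\<close>.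
\<close>

lemma exp_decay_integral_tendsto:
  fixes f :: "real \<Rightarrow> 'a::banach"
  assumes cont: "continuous_on {0..} f" and c: "c > 0"
    and bound: "\<And>t. t \<ge> 0 \<Longrightarrow> norm (f t) \<le> C * exp (- c * t)"
  obtains l where "((\<lambda>T. integral {0..T} f) \<longlongrightarrow> l) at_top" and "norm l \<le> C / c"
proof -
  define I where "I T = integral {0..T} f" for T
  have C: "C \<ge> 0" using bound[of 0] order_trans[OF norm_ge_zero[of "f 0"]] by simp
  have step: "norm (I T' - I T) \<le> C / c * exp (- c * T)" if "0 \<le> T" "T \<le> T'" for T T'
  proof -
    have int: "f integrable_on {a..b}" if "0 \<le> a" for a b
      by (rule integrable_continuous_real, rule continuous_on_subset[OF cont]) (use that in auto)
    have "((\<lambda>t. C * exp (- c * t)) has_integral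
        (- (C / c) * exp (- c * T') - (- (C / c) * exp (- c * T)))) {T..T'}"
      using that c
      by (intro fundamental_theorem_of_calculus)
         (auto intro!: derivative_eq_intros simp flip: has_real_derivative_iff_has_vector_derivative)
    note E = this
    have "I T' - I T = integral {T..T'} f"
      unfolding I_def using Henstock_Kurzweil_Integration.integral_combine[OF that int[of 0 T']] by (simp add: algebra_simps)
    also have "norm \<dots> \<le> integral {T..T'} (\<lambda>t. C * exp (- c * t))"
      using that by (intro Henstock_Kurzweil_Integration.integral_norm_bound_integral int has_integral_integrable[OF E] bound) auto
    also have "\<dots> = C / c * exp (- c * T) - C / c * exp (- c * T')"
      using integral_unique[OF E] by simp
    also have "\<dots> \<le> C / c * exp (- c * T)" using C c by simp
    finally show ?thesis .
  qed
  have decay: "((\<lambda>T. C / c * exp (- c * T)) \<longlongrightarrow> 0) at_top"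
    using c by real_asymp
  have "Cauchy (\<lambda>n. I (real n))"
  proof (rule metric_CauchyI)
    fix r :: real assume "r > 0"
    have "(\<lambda>n. C / c * exp (- c * real n)) \<longlonglongrightarrow> 0"
      by (rule filterlim_compose[OF decay filterlim_real_sequentially])
    then have "eventually (\<lambda>n. C / c * exp (- c * real n) < r) sequentially"
      using \<open>r > 0\<close> by (rule order_tendstoD)
    then obtain N where N: "\<And>n. n \<ge> N \<Longrightarrow> C / c * exp (- c * real n) < r"
      by (auto simp: eventually_sequentially)
    show "\<exists>M. \<forall>m\<ge>M. \<forall>n\<ge>M. dist (I (real m)) (I (real n)) < r"
    proof (intro exI allI impI)
      fix m n assume "N \<le> m" "N \<le> n"
      then show "dist (I (real m)) (I (real n)) < r"
      proof (induction m n rule: linorder_wlog)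
        case (le m n)
        then have "norm (I (real n) - I (real m)) < r"
          using step[of "real m" "real n"] N[of m] by simp
        then show ?case by (simp add: dist_norm norm_minus_commute)
      qed (simp add: dist_commute)
    qed
  qed
  then obtain l where l: "(\<lambda>n. I (real n)) \<longlonglongrightarrow> l"
    by (meson Cauchy_convergent convergentD)
  have rate: "norm (l - I T) \<le> C / c * exp (- c * T)" if "T \<ge> 0" for T
  proof (rule tendsto_upperbound)
    show "(\<lambda>n. norm (I (real n) - I T)) \<longlonglongrightarrow> norm (l - I T)"
      by (intro tendsto_intros l)
    show "\<forall>\<^sub>F n in sequentially. norm (I (real n) - I T) \<le> C / c * exp (- c * T)"
      using eventually_ge_at_top[of "nat \<lceil>T\<rceil>"]
      by eventually_elim (use that in \<open>intro step, auto simp: nat_le_iff ceiling_le_iff\<close>)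
  qed simp
  have "((\<lambda>T. l - I T) \<longlongrightarrow> 0) at_top"
    by (rule Lim_null_comparison[OF eventually_mono[OF eventually_ge_at_top[of 0] rate] decay])
  then have "(I \<longlongrightarrow> l) at_top"
    using tendsto_diff[OF tendsto_const[of l]] by force
  moreover have "norm l \<le> C / c" using rate[of 0] by (simp add: I_def)
  ultimately show thesis using that unfolding I_def by blast
qed

lemma exp_decay_set_integrable:
  fixes g :: "real \<Rightarrow> 'a::euclidean_space"
  assumes cont: "continuous_on {0..} g" and c: "c > 0"
    and bound: "\<And>t. t \<ge> 0 \<Longrightarrow> norm (g t) \<le> C * exp (- c * t)"
  shows "set_integrable lborel {0..} g"
proof (rule set_integrable_bound)
  have "(\<lambda>t. exp (- c * t)) absolutely_integrable_on {0..}"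
    using integrable_on_exp_minus_to_infinity[OF c, of 0]
    by (intro nonnegative_absolutely_integrable_1) auto
  then have "set_integrable lborel {0..} (\<lambda>t. exp (- c * t))"
    by (simp add: set_integrable_def integrable_completion)
  then show "set_integrable lborel {0..} (\<lambda>t. C * exp (- c * t))"
    by (rule set_integrable_mult_right)
  show "set_borel_measurable lborel {0..} g"
    using borel_measurable_continuous_on_indicator[OF _ cont]
    unfolding set_borel_measurable_def by simp
  show "AE t in lborel. t \<in> {0..} \<longrightarrow> norm (g t) \<le> norm (C * exp (- c * t))"
    using order_trans[OF bound abs_ge_self] by (intro AE_I2 impI) simp
qed

lemma set_integral_Ici_eqI:
  fixes g :: "real \<Rightarrow> 'a::euclidean_space"
  assumes "set_integrable lborel {0..} g" and "((\<lambda>T. integral {0..T} g) \<longlongrightarrow> l) at_top"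
  shows "(LINT t:{0..}|lborel. g t) = l"
proof -
  have "((\<lambda>T. LINT t:{0..T}|lborel. g t) \<longlongrightarrow> (LINT t:{0..}|lborel. g t)) at_top"
    by (rule tendsto_set_lebesgue_integral_at_top) (use assms(1) in auto)
  moreover have "(LINT t:{0..T}|lborel. g t) = integral {0..T} g" for T
    by (rule set_borel_integral_eq_integral, rule set_integrable_subset[OF assms(1)]) auto
  ultimately show ?thesis
    using assms(2) by (intro tendsto_unique[OF trivial_limit_at_top_linorder]) simp_all
qed

lemma integral_average_tendsto:
  fixes f :: "real \<Rightarrow> 'a::banach"
  assumes "continuous_on {0..} f"
  shows "((\<lambda>h. integral {0..h} f /\<^sub>R h) \<longlongrightarrow> f 0) (at_right 0)"
proof -
  have "((\<lambda>u. integral {0..u} f) has_vector_derivative f 0) (at 0 within {0..1})"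
    by (intro integral_has_vector_derivative continuous_on_subset[OF assms]) auto
  then have "((\<lambda>h. norm (integral {0..h} f - h *\<^sub>R f 0) / norm h) \<longlongrightarrow> 0) (at_right 0)"
    by (simp add: has_vector_derivative_def has_derivative_iff_norm at_within_Icc_at_right)
  moreover have "\<forall>\<^sub>F h in at_right (0::real).
      norm (integral {0..h} f - h *\<^sub>R f 0) / norm h = norm (integral {0..h} f /\<^sub>R h - f 0)"
    using eventually_at_right_less[of 0]
  proof eventually_elim
    case (elim h)
    then have "integral {0..h} f /\<^sub>R h - f 0 = (integral {0..h} f - h *\<^sub>R f 0) /\<^sub>R h"
      by (simp add: algebra_simps)
    then show ?case
      by (simp only: norm_scaleR divide_inverse abs_inverse real_norm_def mult.commute)
  qed
  ultimately have "((\<lambda>h. norm (integral {0..h} f /\<^sub>R h - f 0)) \<longlongrightarrow> 0) (at_right 0)"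
    by (rule Lim_transform_eventually)
  then show ?thesis by (rule LIM_zero_cancel[OF tendsto_norm_zero_cancel])
qed

text \<open>
  Subdividing \<open>{0..t}\<close> into \<open>n\<close> equal pieces bounds the increment of \<open>g\<close> by
  \<open>n * \<omega> (t / n)\<close>, which tends to \<open>0\<close>.
\<close>

lemma sublinear_increments_imp_const:
  fixes g :: "real \<Rightarrow> 'a::real_normed_vector"
  assumes t: "t \<ge> 0"
    and incr: "\<And>a b. 0 \<le> a \<Longrightarrow> a < b \<Longrightarrow> b \<le> t \<Longrightarrow> norm (g b - g a) \<le> \<omega> (b - a)"
    and small: "((\<lambda>h. \<omega> h / h) \<longlongrightarrow> 0) (at_right 0)"
  shows "g t = g 0"
proof (cases "t = 0")
  case False
  then have t: "t > 0" using t by simp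
  have le: "norm (g t - g 0) \<le> t * (\<omega> (t / real n) / (t / real n))" if n: "n > 0" for n
  proof -
    have "g t - g 0 = (\<Sum>i<n. g (real (Suc i) * (t / real n)) - g (real i * (t / real n)))"
      using n by (subst sum_lessThan_telescope) simp
    also have "norm \<dots> \<le> (\<Sum>i<n. \<omega> (t / real n))"
    proof (rule sum_norm_le)
      fix i assume "i \<in> {..<n}"
      then have "real (Suc i) \<le> real n" by (simp add: Suc_leI)
      then have "real (Suc i) * (t / real n) \<le> real n * (t / real n)"
        using t by (intro mult_right_mono) auto
      then have "real (Suc i) * (t / real n) \<le> t" using n by simp
      then have "norm (g (real (Suc i) * (t / real n)) - g (real i * (t / real n)))
          \<le> \<omega> (real (Suc i) * (t / real n) - real i * (t / real n))"
        using t n by (intro incr mult_strict_right_mono) auto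
      then show "norm (g (real (Suc i) * (t / real n)) - g (real i * (t / real n))) \<le> \<omega> (t / real n)"
        by (simp only: left_diff_distrib[symmetric]) simp
    qed
    finally show ?thesis using t n by (simp add: mult.commute)
  qed
  have "filterlim (\<lambda>n. t / real n) (at_right 0) sequentially"
    using t by real_asymp
  from filterlim_compose[OF small this]
  have "(\<lambda>n. t * (\<omega> (t / real n) / (t / real n))) \<longlonglongrightarrow> t * 0"
    by (rule tendsto_mult_left)
  then have "norm (g t - g 0) \<le> 0"
    by (rule tendsto_lowerbound[THEN ord_le_eq_trans])
       (use le in \<open>auto intro: eventually_sequentiallyI[of 1] simp del: times_divide_eq_right\<close>)
  then show ?thesis by simp
qed simp

section \<open>Exponentially stable semigroups and their generators\<close>

locale stable_semigroup =
  fixes S :: "real \<Rightarrow> 'a::chilbert_space \<Rightarrow> 'a" and \<gamma> :: real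
  assumes semigroup: "strongly_continuous_semigroup S"
    and rate_pos: "\<gamma> > 0"
    and onorm_le: "\<And>t. t \<ge> 0 \<Longrightarrow> onorm (S t) \<le> exp (- \<gamma> * t)"
begin

lemma bounded_linear: "t \<ge> 0 \<Longrightarrow> bounded_linear (S t)"
  using semigroup by (simp add: strongly_continuous_semigroup_def bounded_operator_def)

lemma at_zero [simp]: "S 0 x = x"
  using semigroup by (simp add: strongly_continuous_semigroup_def)

lemma add_time: "s \<ge> 0 \<Longrightarrow> t \<ge> 0 \<Longrightarrow> S (s + t) x = S s (S t x)"
  using semigroup by (simp add: strongly_continuous_semigroup_def)

lemma tendsto_at_zero: "((\<lambda>t. S t x) \<longlongrightarrow> x) (at_right 0)"
  using semigroup by (simp add: strongly_continuous_semigroup_def)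

lemmas diff = linear_diff[OF bounded_linear.linear[OF bounded_linear]]

lemma norm_le: "t \<ge> 0 \<Longrightarrow> norm (S t x) \<le> exp (- \<gamma> * t) * norm x"
  using onorm[OF bounded_linear, of t x] onorm_le[of t]
  by (meson mult_right_mono norm_ge_zero order_trans)

lemma contraction: "t \<ge> 0 \<Longrightarrow> norm (S t x) \<le> norm x"
  using norm_le[of t x] rate_pos mult_right_mono[of "exp (- \<gamma> * t)" 1 "norm x"] by simp

text \<open>
  Contractivity turns right continuity at \<open>0\<close> into two-sided continuity: for \<open>s \<le> t\<close> the
  difference is the image under \<open>S s\<close> of the increment \<open>S (t - s) x - x\<close> at time \<open>0\<close>.
\<close>

lemma norm_diff_le:
  assumes "s \<ge> 0" and "t \<ge> 0"
  shows "norm (S t x - S s x) \<le> norm (S \<bar>t - s\<bar> x - x)"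
  using assms
proof (induction s t rule: linorder_wlog)
  case (le s t)
  then have "S t x - S s x = S s (S (t - s) x - x)"
    using add_time[of s "t - s" x] by (simp add: diff)
  then show ?case using contraction le by simp
next
  case (sym s t)
  then show ?case by (simp add: norm_minus_commute abs_minus_commute)
qed

lemma continuous: "continuous_on {0..} (\<lambda>t. S t x)"
  unfolding continuous_on_def
proof
  fix s :: real assume s: "s \<in> {0..}"
  have zero: "((\<lambda>t. norm (S t x - x)) \<longlongrightarrow> 0) (at_right 0)"
    using tendsto_at_zero[of x] by (simp add: LIM_zero tendsto_norm_zero)
  have "filterlim (\<lambda>t. \<bar>t - s\<bar>) (at_right 0) (at s within {0..})"
    unfolding filterlim_at
  proof
    show "\<forall>\<^sub>F t in at s within {0..}. \<bar>t - s\<bar> \<in> {0<..} \<and> \<bar>t - s\<bar> \<noteq> 0"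
      by (simp add: eventually_at_filter)
    show "((\<lambda>t. \<bar>t - s\<bar>) \<longlongrightarrow> 0) (at s within {0..})"
      by (intro tendsto_eq_intros) auto
  qed
  from filterlim_compose[OF zero this]
  have "((\<lambda>t. norm (S \<bar>t - s\<bar> x - x)) \<longlongrightarrow> 0) (at s within {0..})" .
  moreover have "\<forall>\<^sub>F t in at s within {0..}. norm (S t x - S s x) \<le> norm (S \<bar>t - s\<bar> x - x)"
    using s norm_diff_le by (auto simp: eventually_at_filter)
  ultimately have "((\<lambda>t. S t x - S s x) \<longlongrightarrow> 0) (at s within {0..})"
    by (rule Lim_null_comparison[rotated])
  then show "((\<lambda>t. S t x) \<longlongrightarrow> S s x) (at s within {0..})"
    by (rule LIM_zero_cancel)
qed

text \<open>Since the \<open>S t\<close> are uniformly bounded, strong continuity extends to moving arguments.\<close>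

lemma tendsto_moving:
  assumes f: "(f \<longlongrightarrow> y) (at s within A)" and A: "A \<subseteq> {0..}" "s \<in> {0..}"
  shows "((\<lambda>t. S t (f t)) \<longlongrightarrow> S s y) (at s within A)"
proof -
  have nonneg: "\<forall>\<^sub>F t in at s within A. t \<ge> 0"
    unfolding eventually_at_filter using A by (intro always_eventually) auto
  have "((\<lambda>t. norm (f t - y)) \<longlongrightarrow> 0) (at s within A)"
    by (rule tendsto_norm_zero[OF LIM_zero[OF f]])
  then have "((\<lambda>t. S t (f t - y)) \<longlongrightarrow> 0) (at s within A)"
    by (rule Lim_null_comparison[rotated]) (rule eventually_mono[OF nonneg contraction])
  moreover have "((\<lambda>t. S t y) \<longlongrightarrow> S s y) (at s within A)"
    using continuous A(2) by (intro tendsto_within_subset[OF _ A(1)]) (simp add: continuous_on_def)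
  ultimately have "((\<lambda>t. S t (f t - y) + S t y) \<longlongrightarrow> 0 + S s y) (at s within A)"
    by (rule tendsto_add)
  moreover have "\<forall>\<^sub>F t in at s within A. S t (f t - y) + S t y = S t (f t)"
    using nonneg by eventually_elim (simp add: diff)
  ultimately show ?thesis
    using Lim_transform_eventually by fastforce
qed

lemma generator_invariant:
  assumes gen: "generates D L S" and x: "x \<in> D" and s: "s \<ge> 0"
  shows "S s x \<in> D" and "L (S s x) = S s (L x)"
proof -
  interpret Ss: bounded_linear "S s" by (rule bounded_linear[OF s])
  have "((\<lambda>h. (S h x - x) /\<^sub>R h) \<longlongrightarrow> L x) (at_right 0)"
    using gen x by (simp add: generates_def)
  then have "((\<lambda>h. S s ((S h x - x) /\<^sub>R h)) \<longlongrightarrow> S s (L x)) (at_right 0)"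
    by (rule Ss.tendsto)
  moreover have "\<forall>\<^sub>F h in at_right 0. S s ((S h x - x) /\<^sub>R h) = (S h (S s x) - S s x) /\<^sub>R h"
    using eventually_at_right_less[of 0]
  proof eventually_elim
    case (elim h)
    then show ?case
      using s add_time[of s h x] add_time[of h s x] by (simp add: Ss.scaleR Ss.diff add.commute)
  qed
  ultimately have lim: "((\<lambda>h. (S h (S s x) - S s x) /\<^sub>R h) \<longlongrightarrow> S s (L x)) (at_right 0)"
    by (rule Lim_transform_eventually)
  then show "S s x \<in> D" using gen by (auto simp: generates_def)
  then have "((\<lambda>h. (S h (S s x) - S s x) /\<^sub>R h) \<longlongrightarrow> L (S s x)) (at_right 0)"
    using gen by (simp add: generates_def)
  from tendsto_unique[OF trivial_limit_at_right_real this lim]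
  show "L (S s x) = S s (L x)" .
qed

text \<open>
  For \<open>x\<close> and \<open>y\<close> in the domain, the function \<open>g\<close> given by
  \<open>g s = cinner (S (t - s) x) (S s y)\<close> is constant: over a time step of length \<open>h\<close> the first
  order terms cancel because \<open>L\<close> is symmetric, and by contractivity the remainders are bounded
  by those of \<open>x\<close> and \<open>y\<close> at time \<open>0\<close>, uniformly in \<open>s\<close>. Comparing \<open>s = 0\<close> with \<open>s = t\<close>
  gives symmetry of \<open>S t\<close> on the domain, which is dense.
\<close>

lemma semigroup_symmetric:
  assumes gen: "generates D L S" and dense: "closure D = UNIV"
    and sym: "\<And>x y. x \<in> D \<Longrightarrow> y \<in> D \<Longrightarrow> cinner x (L y) = cinner (L x) y"
    and t: "t \<ge> 0"
  shows "cinner x (S t y) = cinner (S t x) y"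
proof -
  define rem where "rem z h = S h z - z - h *\<^sub>R L z" for z h
  have rem_small: "((\<lambda>h. norm (rem z h) / h) \<longlongrightarrow> 0) (at_right 0)" if "z \<in> D" for z
  proof -
    have "((\<lambda>h. (S h z - z) /\<^sub>R h) \<longlongrightarrow> L z) (at_right 0)"
      using gen that by (simp add: generates_def)
    then have "((\<lambda>h. norm ((S h z - z) /\<^sub>R h - L z)) \<longlongrightarrow> 0) (at_right 0)"
      by (intro tendsto_norm_zero LIM_zero)
    moreover have "\<forall>\<^sub>F h in at_right (0::real). norm ((S h z - z) /\<^sub>R h - L z) = norm (rem z h) / h"
      using eventually_at_right_less[of 0]
    proof eventually_elim
      case (elim h)
      then have "(S h z - z) /\<^sub>R h - L z = rem z h /\<^sub>R h"
        by (simp add: rem_def algebra_simps)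
      then show ?case using elim by (simp add: divide_inverse mult.commute)
    qed
    ultimately show ?thesis by (rule Lim_transform_eventually)
  qed
  have rem_commute: "rem (S s z) h = S s (rem z h)" if "z \<in> D" "s \<ge> 0" "h \<ge> 0" for s h z
  proof -
    interpret Ss: bounded_linear "S s" by (rule bounded_linear[OF that(2)])
    show ?thesis
      using that add_time[of s h z] add_time[of h s z] generator_invariant(2)[OF gen]
      by (simp add: rem_def Ss.diff Ss.scaleR add.commute)
  qed
  have on_domain: "cinner x (S t y) = cinner (S t x) y" if x: "x \<in> D" and y: "y \<in> D" for x y
  proof -
    define g where "g s = cinner (S (t - s) x) (S s y)" for s
    have "g t = g 0"
    proof (rule sublinear_increments_imp_const[OF t])
      fix a b :: real assume ab: "0 \<le> a" "a < b" "b \<le> t"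
      define h where "h = b - a"
      define u where "u = S (t - b) x"
      define v where "v = S a y"
      have u: "u \<in> D" and v: "v \<in> D"
        unfolding u_def v_def using generator_invariant(1)[OF gen] x y ab by auto
      have "g b - g a = cinner u (S h v) - cinner (S h u) v"
        using ab add_time[of h a y] add_time[of h "t - b" x]
        by (simp add: g_def u_def v_def h_def)
      also have "\<dots> = cinner u (rem v h) - cinner (rem u h) v"
        using sym[OF u v]
        by (simp add: rem_def cinner.diff_left cinner.diff_right cinner.scaleR_left cinner.scaleR_right)
      also have "norm \<dots> \<le> norm u * norm (rem v h) + norm (rem u h) * norm v"
        using cinner_Cauchy_Schwarz[of u "rem v h"] cinner_Cauchy_Schwarz[of "rem u h" v]
          norm_triangle_ineq4[of "cinner u (rem v h)" "cinner (rem u h) v"] by linarith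
      also have "\<dots> \<le> norm x * norm (rem y h) + norm (rem x h) * norm y"
        using ab x y
        by (intro add_mono mult_mono) (auto simp: u_def v_def h_def rem_commute contraction)
      finally show "norm (g b - g a) \<le> norm x * norm (rem y (b - a)) + norm (rem x (b - a)) * norm y"
        by (simp add: h_def)
    next
      have "((\<lambda>h. norm x * (norm (rem y h) / h) + norm (rem x h) / h * norm y)
          \<longlongrightarrow> norm x * 0 + 0 * norm y) (at_right 0)"
        by (intro tendsto_intros rem_small x y)
      then show "((\<lambda>h. (norm x * norm (rem y h) + norm (rem x h) * norm y) / h) \<longlongrightarrow> 0) (at_right 0)"
        by (simp add: add_divide_distrib)
    qed
    then show ?thesis by (simp add: g_def)
  qed
  have cont: "continuous_on A (S t)" for A
    by (rule linear_continuous_on[OF bounded_linear[OF t]])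
  have ext: "cinner x (S t y) = cinner (S t x) y" if x: "x \<in> D" for x y
  proof (rule continuous_constant_on_closure[where S = D and a = 0
        and f = "\<lambda>y. cinner x (S t y) - cinner (S t x) y", simplified])
    show "continuous_on (closure D) (\<lambda>y. cinner x (S t y) - cinner (S t x) y)"
      by (intro continuous_intros cinner.continuous_on cont)
    show "cinner x (S t z) = cinner (S t x) z" if "z \<in> D" for z
      using on_domain[OF x that] .
    show "y \<in> closure D" by (simp add: dense)
  qed
  show ?thesis
  proof (rule continuous_constant_on_closure[where S = D and a = 0
        and f = "\<lambda>x. cinner x (S t y) - cinner (S t x) y", simplified])
    show "continuous_on (closure D) (\<lambda>x. cinner x (S t y) - cinner (S t x) y)"
      by (intro continuous_intros cinner.continuous_on cont)
    show "cinner z (S t y) = cinner (S t z) y" if "z \<in> D" for z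
      using ext[OF that] .
    show "x \<in> closure D" by (simp add: dense)
  qed
qed

end

section \<open>The energy covariance operator\<close>

locale forced_semigroup = stable_semigroup S \<gamma>
  for S :: "real \<Rightarrow> 'a::chilbert_space \<Rightarrow> 'a" and \<gamma> :: real +
  fixes Q :: "'a \<Rightarrow> 'a"
  assumes bounded_linear_Q: "bounded_linear Q"
begin

abbreviation P :: "'a \<Rightarrow> 'a" where "P \<equiv> energy_covariance S Q"

definition integrand :: "'a \<Rightarrow> real \<Rightarrow> 'a" where
  "integrand \<psi> t = S t (Q (S t \<psi>))"

lemma continuous_integrand: "continuous_on {0..} (integrand \<psi>)"
  unfolding continuous_on_def integrand_def
  using continuous[of \<psi>] bounded_linear.tendsto[OF bounded_linear_Q]
  by (auto simp: continuous_on_def intro!: tendsto_moving)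

text \<open>One factor \<open>exp (- \<gamma> * t)\<close> comes from each of the two copies of \<open>S t\<close>.\<close>

lemma norm_integrand_le:
  assumes "t \<ge> 0"
  shows "norm (integrand \<psi> t) \<le> onorm Q * norm \<psi> * exp (- (2 * \<gamma>) * t)"
proof -
  have "norm (integrand \<psi> t) \<le> exp (- \<gamma> * t) * norm (Q (S t \<psi>))"
    unfolding integrand_def by (rule norm_le[OF assms])
  also have "\<dots> \<le> exp (- \<gamma> * t) * (onorm Q * (exp (- \<gamma> * t) * norm \<psi>))"
    by (intro mult_left_mono order_trans[OF onorm[OF bounded_linear_Q]] norm_le assms
        onorm_pos_le[OF bounded_linear_Q]) auto
  also have "\<dots> = onorm Q * norm \<psi> * exp (- (2 * \<gamma>) * t)"
    by (simp add: exp_add[symmetric])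
  finally show ?thesis .
qed

lemma integrand_integrable: "0 \<le> a \<Longrightarrow> integrand \<psi> integrable_on {a..b}"
  by (rule integrable_continuous_real, rule continuous_on_subset[OF continuous_integrand]) auto

lemma set_integrable_cinner_integrand:
  "set_integrable lborel {0..} (\<lambda>t. cinner \<phi> (integrand \<psi> t))"
proof (rule exp_decay_set_integrable)
  show "continuous_on {0..} (\<lambda>t. cinner \<phi> (integrand \<psi> t))"
    by (intro cinner.continuous_on continuous_on_const continuous_integrand)
  show "2 * \<gamma> > 0" using rate_pos by simp
  show "norm (cinner \<phi> (integrand \<psi> t)) \<le> norm \<phi> * (onorm Q * norm \<psi>) * exp (- (2 * \<gamma>) * t)"
    if "t \<ge> 0" for t
    using order_trans[OF cinner_Cauchy_Schwarz mult_left_mono[OF norm_integrand_le[OF that] norm_ge_zero]]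
    by (simp add: mult.assoc)
qed

text \<open>
  The weak integral that defines \<open>P \<psi>\<close> is a strong one: the vector integrals over
  \<open>{0..T}\<close> converge in norm, and their limit represents the weak integral because \<open>cinner \<phi>\<close>
  is continuous and linear. In particular the description that defines \<open>P \<psi>\<close> denotes.
\<close>

lemma energy_covariance_represents:
  shows integral_tendsto: "((\<lambda>T. integral {0..T} (integrand \<psi>)) \<longlongrightarrow> P \<psi>) at_top"
    and cinner_energy_covariance: "cinner \<phi> (P \<psi>) = (LINT t:{0..}|lborel. cinner \<phi> (integrand \<psi> t))"
    and norm_energy_covariance_le: "norm (P \<psi>) \<le> norm \<psi> * (onorm Q / (2 * \<gamma>))"
proof -
  obtain l where l: "((\<lambda>T. integral {0..T} (integrand \<psi>)) \<longlongrightarrow> l) at_top"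
    and norm_l: "norm l \<le> onorm Q * norm \<psi> / (2 * \<gamma>)"
    using exp_decay_integral_tendsto[OF continuous_integrand _ norm_integrand_le] rate_pos
    by (metis mult_pos_pos zero_less_numeral)
  have weak: "(LINT t:{0..}|lborel. cinner \<phi> (integrand \<psi> t)) = cinner \<phi> l" for \<phi>
  proof (rule set_integral_Ici_eqI[OF set_integrable_cinner_integrand])
    have "integral {0..T} (\<lambda>t. cinner \<phi> (integrand \<psi> t)) = cinner \<phi> (integral {0..T} (integrand \<psi>))" for T
      using integral_linear[OF integrand_integrable[OF order_refl] cinner.bounded_linear_right]
      by (simp add: o_def)
    then show "((\<lambda>T. integral {0..T} (\<lambda>t. cinner \<phi> (integrand \<psi> t))) \<longlongrightarrow> cinner \<phi> l) at_top"
      using cinner.tendsto[OF tendsto_const l] by simp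
  qed
  have "P \<psi> = l"
    unfolding energy_covariance_def integrand_def[symmetric]
  proof (rule the_equality)
    show "\<forall>\<phi>. cinner \<phi> l = (LINT t:{0..}|lborel. cinner \<phi> (integrand \<psi> t))"
      by (simp add: weak)
    show "m = l" if "\<forall>\<phi>. cinner \<phi> m = (LINT t:{0..}|lborel. cinner \<phi> (integrand \<psi> t))" for m
      using that weak by (intro cinner_eqI) simp
  qed
  then show "((\<lambda>T. integral {0..T} (integrand \<psi>)) \<longlongrightarrow> P \<psi>) at_top"
    and "cinner \<phi> (P \<psi>) = (LINT t:{0..}|lborel. cinner \<phi> (integrand \<psi> t))"
    and "norm (P \<psi>) \<le> norm \<psi> * (onorm Q / (2 * \<gamma>))"
    using l weak norm_l by (simp_all add: mult.commute)
qed

lemma bounded_linear_energy_covariance: "bounded_linear P"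
proof (rule bounded_linear_intro[OF _ _ norm_energy_covariance_le])
  interpret Q: bounded_linear Q by (rule bounded_linear_Q)
  have lin: "integrand (x + y) t = integrand x t + integrand y t"
    "integrand (r *\<^sub>R x) t = r *\<^sub>R integrand x t" if "t \<ge> 0" for x y r t
  proof -
    interpret St: bounded_linear "S t" by (rule bounded_linear[OF that])
    show "integrand (x + y) t = integrand x t + integrand y t"
      "integrand (r *\<^sub>R x) t = r *\<^sub>R integrand x t"
      by (simp_all add: integrand_def St.add St.scaleR Q.add Q.scaleR)
  qed
  fix x y :: 'a and r :: real
  have "integral {0..T} (integrand (x + y)) = integral {0..T} (integrand x) + integral {0..T} (integrand y)" for T
  proof -
    have "integral {0..T} (integrand (x + y)) = integral {0..T} (\<lambda>t. integrand x t + integrand y t)"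
      by (rule integral_cong) (simp add: lin)
    also have "\<dots> = integral {0..T} (integrand x) + integral {0..T} (integrand y)"
      by (intro Henstock_Kurzweil_Integration.integral_add integrand_integrable order_refl)
    finally show ?thesis .
  qed
  then show "P (x + y) = P x + P y"
    using tendsto_add[OF integral_tendsto[of x] integral_tendsto[of y]]
    by (intro tendsto_unique[OF trivial_limit_at_top_linorder integral_tendsto]) simp
  have "integral {0..T} (integrand (r *\<^sub>R x)) = r *\<^sub>R integral {0..T} (integrand x)" for T
  proof -
    have "integral {0..T} (integrand (r *\<^sub>R x)) = integral {0..T} (\<lambda>t. r *\<^sub>R integrand x t)"
      by (rule integral_cong) (simp add: lin)
    then show ?thesis by simp
  qed
  then show "P (r *\<^sub>R x) = r *\<^sub>R P x"
    using tendsto_scaleR[OF tendsto_const[of r] integral_tendsto[of x]]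
    by (intro tendsto_unique[OF trivial_limit_at_top_linorder integral_tendsto]) simp
qed

text \<open>
  Conjugating \<open>P\<close> with \<open>S h\<close> shifts the time variable by \<open>h\<close> and thus cuts the piece over
  \<open>{0..h}\<close> off the integral. This is the Lyapunov equation in integrated form.
\<close>

lemma energy_covariance_conjugate:
  assumes h: "h \<ge> 0"
  shows "S h (P (S h \<psi>)) = P \<psi> - integral {0..h} (integrand \<psi>)"
proof (rule tendsto_unique[OF trivial_limit_at_top_linorder])
  interpret Sh: bounded_linear "S h" by (rule bounded_linear[OF h])
  show "((\<lambda>T. S h (integral {0..T} (integrand (S h \<psi>)))) \<longlongrightarrow> S h (P (S h \<psi>))) at_top"
    by (rule Sh.tendsto[OF integral_tendsto])
  have "filterlim (\<lambda>T. T + h) at_top at_top"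
    by (rule filterlim_at_top_mono[OF filterlim_ident]) (use h in auto)
  from filterlim_compose[OF integral_tendsto this]
  have "((\<lambda>T. integral {0..T + h} (integrand \<psi>) - integral {0..h} (integrand \<psi>))
      \<longlongrightarrow> P \<psi> - integral {0..h} (integrand \<psi>)) at_top"
    by (intro tendsto_diff tendsto_const)
  moreover have "\<forall>\<^sub>F T in at_top. integral {0..T + h} (integrand \<psi>) - integral {0..h} (integrand \<psi>)
      = S h (integral {0..T} (integrand (S h \<psi>)))"
    using eventually_ge_at_top[of 0]
  proof eventually_elim
    case (elim T)
    have "integral {0..T + h} (integrand \<psi>) - integral {0..h} (integrand \<psi>)
        = integral {0 + h..T + h} (integrand \<psi>)"
      using Henstock_Kurzweil_Integration.integral_combine[OF h _ integrand_integrable[OF order_refl], of "T + h" \<psi>] elim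
      by (simp add: algebra_simps)
    also have "\<dots> = integral {0..T} (integrand \<psi> \<circ> (+) h)"
      by (rule integral_shift_Icc_real[symmetric])
    also have "\<dots> = integral {0..T} (S h \<circ> integrand (S h \<psi>))"
    proof (rule integral_cong)
      fix t assume "t \<in> {0..T}"
      then have t: "t \<ge> 0" by simp
      show "(integrand \<psi> \<circ> (+) h) t = (S h \<circ> integrand (S h \<psi>)) t"
        using add_time[OF h t] add_time[OF t h] by (simp add: integrand_def add.commute)
    qed
    also have "\<dots> = S h (integral {0..T} (integrand (S h \<psi>)))"
      by (rule integral_linear[OF integrand_integrable[OF order_refl] Sh.bounded_linear_axioms])
    finally show ?case .
  qed
  ultimately show "((\<lambda>T. S h (integral {0..T} (integrand (S h \<psi>))))
      \<longlongrightarrow> P \<psi> - integral {0..h} (integrand \<psi>)) at_top"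
    by (rule Lim_transform_eventually)
qed

text \<open>
  Dividing the integrated form by \<open>h\<close> and letting \<open>h\<close> tend to \<open>0\<close> shows that the difference
  quotients of \<open>P \<psi>\<close> converge. The domain of a generator consists of the vectors for which they
  do, so this argument yields the membership of \<open>P \<psi>\<close> in \<open>D\<close> together with the equation.
\<close>

lemma lyapunov_equation:
  assumes gen: "generates D L S" and \<psi>: "\<psi> \<in> D"
  shows "P \<psi> \<in> D" and "L (P \<psi>) + P (L \<psi>) = - Q \<psi>"
proof -
  interpret P: bounded_linear P by (rule bounded_linear_energy_covariance)
  have quot: "((\<lambda>h. (S h \<psi> - \<psi>) /\<^sub>R h) \<longlongrightarrow> L \<psi>) (at_right 0)"
    using gen \<psi> by (simp add: generates_def)
  define f where "f h = P ((S h \<psi> - \<psi>) /\<^sub>R h)" for h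
  have "(f \<longlongrightarrow> P (L \<psi>)) (at_right 0)"
    unfolding f_def by (rule P.tendsto[OF quot])
  then have "((\<lambda>h. S h (f h)) \<longlongrightarrow> S 0 (P (L \<psi>))) (at_right 0)"
    by (rule tendsto_moving) auto
  then have "((\<lambda>h. S h (f h)) \<longlongrightarrow> P (L \<psi>)) (at_right 0)"
    by simp
  then have "((\<lambda>h. - S h (f h) - integral {0..h} (integrand \<psi>) /\<^sub>R h)
      \<longlongrightarrow> - P (L \<psi>) - integrand \<psi> 0) (at_right 0)"
    by (intro tendsto_diff tendsto_minus integral_average_tendsto continuous_integrand)
  moreover have "\<forall>\<^sub>F h in at_right 0. - S h (f h) - integral {0..h} (integrand \<psi>) /\<^sub>R h
      = (S h (P \<psi>) - P \<psi>) /\<^sub>R h"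
    using eventually_at_right_less[of 0]
  proof eventually_elim
    case (elim h)
    interpret Sh: bounded_linear "S h" using elim by (intro bounded_linear) simp
    have "- S h (f h) = (S h (P \<psi>) - S h (P (S h \<psi>))) /\<^sub>R h"
      using elim by (simp add: f_def P.scaleR P.diff Sh.scaleR Sh.diff algebra_simps)
    also have "\<dots> = (S h (P \<psi>) - P \<psi>) /\<^sub>R h + integral {0..h} (integrand \<psi>) /\<^sub>R h"
      using elim by (simp add: energy_covariance_conjugate algebra_simps)
    finally show ?case by simp
  qed
  ultimately have lim: "((\<lambda>h. (S h (P \<psi>) - P \<psi>) /\<^sub>R h) \<longlongrightarrow> - P (L \<psi>) - integrand \<psi> 0) (at_right 0)"
    by (rule Lim_transform_eventually)
  then show mem: "P \<psi> \<in> D" using gen by (auto simp: generates_def)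
  then have "((\<lambda>h. (S h (P \<psi>) - P \<psi>) /\<^sub>R h) \<longlongrightarrow> L (P \<psi>)) (at_right 0)"
    using gen by (simp add: generates_def)
  from tendsto_unique[OF trivial_limit_at_right_real this lim]
  show "L (P \<psi>) + P (L \<psi>) = - Q \<psi>" by (simp add: integrand_def)
qed

text \<open>
  Moving both copies of \<open>S t\<close> and \<open>Q\<close> across the inner product exchanges the roles of
  \<open>\<phi>\<close> and \<open>\<psi>\<close> under the integral, up to conjugation.
\<close>

lemma cinner_energy_covariance_symmetric:
  assumes S: "\<And>t x y. t \<ge> 0 \<Longrightarrow> cinner x (S t y) = cinner (S t x) y"
    and Q: "\<And>x y. cinner x (Q y) = cinner (Q x) y"
  shows "cinner \<phi> (P \<psi>) = cinner (P \<phi>) \<psi>"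
proof -
  have "cinner \<phi> (P \<psi>) = (LINT t:{0..}|lborel. cnj (cinner \<psi> (integrand \<phi> t)))"
    unfolding cinner_energy_covariance
  proof (rule set_lebesgue_integral_cong)
    have "cinner \<phi> (integrand \<psi> t) = cinner (integrand \<phi> t) \<psi>" if "t \<ge> 0" for t
      by (simp add: integrand_def S[OF that] Q)
    then show "\<forall>t. t \<in> {0..} \<longrightarrow> cinner \<phi> (integrand \<psi> t) = cnj (cinner \<psi> (integrand \<phi> t))"
      by (metis atLeast_iff cinner_commute)
  qed simp
  also have "\<dots> = cnj (cinner \<psi> (P \<phi>))"
    by (simp add: cinner_energy_covariance set_lebesgue_integral_def flip: integral_cnj complex_cnj_scaleR)
  finally show ?thesis using cinner_commute by metis
qed

text \<open>
  By symmetry of \<open>S t\<close> the scalar integrand is \<open>cinner (S t \<phi>) (Q (S t \<phi>))\<close>. Being nonnegative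
  in the order of the complex numbers it is real, so that the integral is that of its real part.
\<close>

lemma energy_covariance_nonneg:
  assumes S: "\<And>t x y. t \<ge> 0 \<Longrightarrow> cinner x (S t y) = cinner (S t x) y"
    and Q: "positive_operator Q"
  shows "0 \<le> cinner \<phi> (P \<phi>)"
proof -
  have pos: "0 \<le> cinner \<phi> (integrand \<phi> t)" if "t \<ge> 0" for t
    using Q S[OF that, of \<phi>] by (simp add: integrand_def positive_operator_def)
  have "cinner \<phi> (P \<phi>) = (LINT t:{0..}|lborel. complex_of_real (Re (cinner \<phi> (integrand \<phi> t))))"
    unfolding cinner_energy_covariance
    by (rule set_lebesgue_integral_cong) (use pos in \<open>auto simp: less_eq_complex_def complex_eq_iff\<close>)
  also have "\<dots> = complex_of_real (LINT t:{0..}|lborel. Re (cinner \<phi> (integrand \<phi> t)))"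
    by (rule set_integral_complex_of_real)
  also have "\<dots> \<ge> 0"
    unfolding set_lebesgue_integral_def
    using pos by (auto simp: less_eq_complex_def indicator_def intro!: integral_nonneg_AE AE_I2)
  finally show ?thesis .
qed

end

section \<open>The Lyapunov equation for the energy covariance\<close>

theorem theorem2p5:
  fixes D :: "'a::chilbert_space set"
    and L Q P :: "'a \<Rightarrow> 'a"
    and S :: "real \<Rightarrow> 'a \<Rightarrow> 'a"
    and e :: "nat \<Rightarrow> 'a"
    and lam :: "nat \<Rightarrow> real"
    and \<gamma> :: real
  assumes "linear_operator D L" and "densely_defined D"
    and "self_adjoint D L"
    and "\<gamma> > 0"
    and "\<And>\<phi>. \<phi> \<in> D \<Longrightarrow> cinner \<phi> (L \<phi>) \<le> complex_of_real (- \<gamma> * (norm \<phi>)\<^sup>2)"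
    and "complete_orthonormal_system e"
    and "\<And>k. e k \<in> D"
    and "\<And>k. L (e k) = complex_of_real (lam k) *\<^sub>C e k"
    and "\<And>k. lam k < 0"
    and "strongly_continuous_semigroup S"
    and "generates D L S"
    and "\<And>t. t \<ge> 0 \<Longrightarrow> onorm (S t) \<le> exp (- \<gamma> * t)"
    and "bounded_operator Q" and "positive_operator Q" and "self_adjoint UNIV Q"
    and "P = energy_covariance S Q"
  shows "(\<forall>\<phi> \<psi>. cinner \<phi> (P \<psi>) = (LINT t:{0..}|lborel. cinner \<phi> (S t (Q (S t \<psi>))))) \<and>
    (\<forall>\<phi>. 0 \<le> cinner \<phi> (P \<phi>)) \<and>
    self_adjoint UNIV P \<and>
    (\<forall>\<psi>\<in>D. P \<psi> \<in> D \<and> L (P \<psi>) + P (L \<psi>) = - Q \<psi>) \<and>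
    (\<forall>\<phi> \<psi>. set_integrable lborel {0..} (\<lambda>t. cinner \<phi> (S t (Q (S t \<psi>)))))"
proof -
  interpret forced_semigroup S \<gamma> Q
    using assms by (auto simp: bounded_operator_def
        intro!: forced_semigroup.intro stable_semigroup.intro forced_semigroup_axioms.intro)
  have dense: "closure D = UNIV" using assms by (simp add: densely_defined_def)
  have S: "cinner x (S t y) = cinner (S t x) y" if "t \<ge> 0" for t x y
    using semigroup_symmetric[OF \<open>generates D L S\<close> dense _ that]
      self_adjoint_symmetric[OF \<open>self_adjoint D L\<close> dense] by blast
  have Q: "cinner x (Q y) = cinner (Q x) y" for x y
    using self_adjoint_symmetric[OF \<open>self_adjoint UNIV Q\<close>] by simp
  show ?thesis
    unfolding \<open>P = energy_covariance S Q\<close> integrand_def[symmetric]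
  proof (intro conjI allI ballI)
    show "self_adjoint UNIV (energy_covariance S Q)"
      by (intro symmetric_imp_self_adjoint cinner_energy_covariance_symmetric S Q)
    show "0 \<le> cinner \<phi> (energy_covariance S Q \<phi>)" for \<phi>
      by (intro energy_covariance_nonneg S \<open>positive_operator Q\<close>)
  qed (use lyapunov_equation[OF \<open>generates D L S\<close>] in
      \<open>simp_all add: cinner_energy_covariance set_integrable_cinner_integrand\<close>)
qed

end
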